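(* On a uniform metric (all distinct points at distance $1$), the First-In-First-Out (FIFO) algorithm for the $k$-server (paging) problem is $(1,1)$-fair: for every request sequence $\sigma$ and every server $i$, $c_i\le \frac{\mathrm{cost}(\mathrm{FIFO},\sigma)}{k}+1$.
   Context: $k$-server problem on a uniform metric (equivalently paging): $k$ servers (cache slots) occupy points (pages); when a request arrives at a point with no server (a fault), a server must move there at cost $1$; otherwise nothing happens (lazy algorithm). $c_i$ is the total cost of server $i$ and $\mathrm{cost}=\sum_i c_i$. FIFO, on a fault, moves the server whose current page has been in the cache the longest (i.e. the server whose most recent move is oldest, with initially placed servers ordered by their placement). *)

theory Defs
  imports "HOL-Analysis.Abstract_Metric_Spaces"
begin

text \<open>
  Servers are the numbers \<open>0, \<dots>, k - 1\<close>; a configuration gives the position of each server, and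
  only its values below \<open>k\<close> matter. Servers may share a point. An online algorithm, started in a
  fixed initial configuration, maps the list of requests seen so far to the configuration reached
  after serving them; its value at \<open>[]\<close> is the initial configuration.
\<close>

type_synonym 'p config = "nat \<Rightarrow> 'p"
type_synonym 'p online_alg = "'p list \<Rightarrow> 'p config"

definition uniform_metric :: "'p set \<Rightarrow> ('p \<Rightarrow> 'p \<Rightarrow> real) \<Rightarrow> bool" where
  "uniform_metric M d \<longleftrightarrow> Metric_space M d \<and> (\<forall>x\<in>M. \<forall>y\<in>M. x \<noteq> y \<longrightarrow> d x y = 1)"

definition server_cost ::
  "('p \<Rightarrow> 'p \<Rightarrow> real) \<Rightarrow> 'p online_alg \<Rightarrow> 'p list \<Rightarrow> nat \<Rightarrow> real" where
  "server_cost d A \<sigma> i = (\<Sum>t<length \<sigma>. d (A (take t \<sigma>) i) (A (take (Suc t) \<sigma>) i))"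

definition total_cost ::
  "('p \<Rightarrow> 'p \<Rightarrow> real) \<Rightarrow> nat \<Rightarrow> 'p online_alg \<Rightarrow> 'p list \<Rightarrow> real" where
  "total_cost d k A \<sigma> = (\<Sum>i<k. server_cost d A \<sigma> i)"

definition fair ::
  "'p set \<Rightarrow> ('p \<Rightarrow> 'p \<Rightarrow> real) \<Rightarrow> nat \<Rightarrow> real \<Rightarrow> real \<Rightarrow> 'p online_alg \<Rightarrow> bool" where
  "fair M d k \<alpha> \<beta> A \<longleftrightarrow>
    (\<forall>\<sigma>. set \<sigma> \<subseteq> M \<longrightarrow>
      (\<forall>i<k. server_cost d A \<sigma> i \<le> \<alpha> * (total_cost d k A \<sigma> / real k) + \<beta>))"

text \<open>
  The FIFO state \<open>(C, \<tau>, t)\<close> consists of the configuration, the time \<open>\<tau> i\<close> of the most recent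
  move (or of the initial placement) of each server \<open>i\<close>, and the time \<open>t\<close> of the next request.
  Requests arrive at times \<open>1, 2, \<dots>\<close>, so initial placements are meant to have pairwise
  distinct times \<open>\<le> 0\<close>. All times are then distinct and the minimiser is unique.
\<close>

fun fifo_step ::
  "nat \<Rightarrow> 'p \<Rightarrow> 'p config \<times> (nat \<Rightarrow> int) \<times> int \<Rightarrow> 'p config \<times> (nat \<Rightarrow> int) \<times> int" where
  "fifo_step k r (C, \<tau>, t) =
    (if \<exists>i<k. C i = r then (C, \<tau>, t + 1)
     else let j = arg_min_on \<tau> {..<k} in (C(j := r), \<tau>(j := t), t + 1))"

definition fifo :: "nat \<Rightarrow> 'p config \<Rightarrow> (nat \<Rightarrow> int) \<Rightarrow> 'p online_alg" where
  "fifo k C\<^sub>0 \<tau>\<^sub>0 \<sigma> = fst (fold (fifo_step k) \<sigma> (C\<^sub>0, \<tau>\<^sub>0, 1))"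

end

theory Submission
  imports Defs
begin

text \<open>
  FIFO moves the servers cyclically, in the order of their last moves. Hence, whenever server \<open>i\<close>
  moved before server \<open>j\<close>, their costs satisfy \<open>c\<^sub>i \<le> c\<^sub>j \<le> c\<^sub>i + 1\<close>, and a fault preserves this
  since it charges the oldest server, which then becomes the youngest. So any two costs differ by
  at most 1; averaging \<open>c\<^sub>i \<le> c\<^sub>j + 1\<close> over \<open>j\<close> gives the bound.
\<close>

lemma server_cost_snoc:
  "server_cost d A (\<sigma> @ [r]) i = server_cost d A \<sigma> i + d (A \<sigma> i) (A (\<sigma> @ [r]) i)"
  by (simp add: server_cost_def)

text \<open>The order of ages alone does not carry the induction. Distinct time stamps make the
  oldest server strictly oldest, stamps below the clock make a server that moves now strictly
  youngest, and positions in \<open>M\<close> allow distances to be evaluated as 0 or 1.\<close>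

lemma fifo_invariant:
  fixes d :: "'p \<Rightarrow> 'p \<Rightarrow> real"
  assumes d: "uniform_metric M d"
    and "k \<ge> 1"
    and C0: "\<And>i. i < k \<Longrightarrow> C\<^sub>0 i \<in> M"
    and "inj_on \<tau>\<^sub>0 {..<k}"
    and \<tau>0: "\<And>i. i < k \<Longrightarrow> \<tau>\<^sub>0 i \<le> 0"
    and "set \<sigma> \<subseteq> M"
    and "fold (fifo_step k) \<sigma> (C\<^sub>0, \<tau>\<^sub>0, 1) = (C, \<tau>, t)"
  defines "cost \<equiv> server_cost d (fifo k C\<^sub>0 \<tau>\<^sub>0)"
  shows "inj_on \<tau> {..<k} \<and> (\<forall>i<k. C i \<in> M \<and> \<tau> i < t) \<and>
    (\<forall>i<k. \<forall>j<k. \<tau> i < \<tau> j \<longrightarrow> cost \<sigma> i \<le> cost \<sigma> j \<and> cost \<sigma> j \<le> cost \<sigma> i + 1)"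
  using \<open>set \<sigma> \<subseteq> M\<close> \<open>fold (fifo_step k) \<sigma> (C\<^sub>0, \<tau>\<^sub>0, 1) = (C, \<tau>, t)\<close>
proof (induction \<sigma> arbitrary: C \<tau> t rule: rev_induct)
  case Nil
  \<comment> \<open>The clock starts at 1, after all placement times, and all costs are empty
    sums.\<close>
  then show ?case
    using C0 \<open>inj_on \<tau>\<^sub>0 {..<k}\<close> \<tau>0 by (force simp: cost_def server_cost_def)
next
  case (snoc r \<sigma>)
  obtain C' \<tau>' t' where old: "fold (fifo_step k) \<sigma> (C\<^sub>0, \<tau>\<^sub>0, 1) = (C', \<tau>', t')"
    using prod_cases3 by blast
  have r: "r \<in> M" and "set \<sigma> \<subseteq> M" using snoc.prems by auto
  from snoc.IH[OF this(2) old]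
  have inj: "inj_on \<tau>' {..<k}"
    and C': "\<And>i. i < k \<Longrightarrow> C' i \<in> M"
    and \<tau>': "\<And>i. i < k \<Longrightarrow> \<tau>' i < t'"
    and ord: "\<And>i j. i < k \<Longrightarrow> j < k \<Longrightarrow> \<tau>' i < \<tau>' j \<Longrightarrow>
      cost \<sigma> i \<le> cost \<sigma> j \<and> cost \<sigma> j \<le> cost \<sigma> i + 1"
    by auto
  have step: "fifo_step k r (C', \<tau>', t') = (C, \<tau>, t)"
    using snoc.prems old by simp
  have cost: "cost (\<sigma> @ [r]) i = cost \<sigma> i + d (C' i) (C i)" for i
    using snoc.prems(2) old by (simp add: cost_def server_cost_snoc fifo_def)
  have d0: "d x x = 0" if "x \<in> M" for x
    using d that by (auto simp: uniform_metric_def Metric_space.zero)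
  show ?case
  proof (cases "\<exists>i<k. C' i = r")
    case True
    then have "C = C'" "\<tau> = \<tau>'" "t = t' + 1" using step by auto
    \<comment> \<open>Without a fault every server stays put, at cost \<open>d x x = 0\<close>; only
      the clock advances.\<close>
    then show ?thesis
      using inj C' \<tau>' ord by (force simp: cost d0)
  next
    case False
    define m where "m = arg_min_on \<tau>' {..<k}"
    have ne: "finite {..<k}" "{..<k} \<noteq> {}" using \<open>k \<ge> 1\<close> by (auto simp: lessThan_empty_iff)
    have m: "m < k"
      using arg_min_if_finite(1)[OF ne, of \<tau>'] by (simp add: m_def)
    \<comment> \<open>Minimality gives only a weak inequality; injectivity of the time stamps makes
      it strict, as \<open>ord\<close> demands.\<close>
    have least: "\<tau>' m < \<tau>' j" if "j < k" "j \<noteq> m" for j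
    proof -
      have "\<not> \<tau>' j < \<tau>' m"
        using arg_min_if_finite(2)[OF ne, of \<tau>'] that by (auto simp: m_def)
      moreover have "\<tau>' j \<noteq> \<tau>' m"
        using inj m that by (auto dest: inj_onD)
      ultimately show ?thesis by simp
    qed
    have new: "C = C'(m := r)" "\<tau> = \<tau>'(m := t')" "t = t' + 1"
      using step False by (auto simp: m_def Let_def)
    \<comment> \<open>On a fault \<open>C' m\<close> differs from \<open>r\<close>, so the move has
      length exactly 1.\<close>
    have costm: "cost (\<sigma> @ [r]) m = cost \<sigma> m + 1"
      using d C'[OF m] r m False by (auto simp: cost new uniform_metric_def)
    have costj: "cost (\<sigma> @ [r]) j = cost \<sigma> j" if "j < k" "j \<noteq> m" for j
      using that C' by (simp add: cost new d0)
    have "inj_on \<tau> {..<k}"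
      using inj \<tau>' by (fastforce simp: new inj_on_def)
    moreover have "C i \<in> M \<and> \<tau> i < t" if "i < k" for i
      using that C' \<tau>' r by (force simp: new)
    moreover have "cost (\<sigma> @ [r]) i \<le> cost (\<sigma> @ [r]) j \<and>
        cost (\<sigma> @ [r]) j \<le> cost (\<sigma> @ [r]) i + 1"
      if "i < k" "j < k" "\<tau> i < \<tau> j" for i j
    proof -
      \<comment> \<open>The new stamp \<open>t'\<close> of \<open>m\<close> exceeds all others, so
        \<open>m\<close> cannot be the older of two servers.\<close>
      have "i \<noteq> m"
        using that \<tau>'[of j] by (auto simp: new split: if_splits)
      show ?thesis
      proof (cases "j = m")
        case True
        \<comment> \<open>Before the fault \<open>m\<close> was older than \<open>i\<close>, so the
          cost of \<open>i\<close> was between that of \<open>m\<close> and that plus 1. Charging 1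
          to \<open>m\<close> swaps the roles of the two bounds, just as the ages are
          swapped.\<close>
        then show ?thesis
          using ord[OF m \<open>i < k\<close> least] \<open>i < k\<close> \<open>i \<noteq> m\<close> by (simp add: costm costj)
      next
        case False
        \<comment> \<open>Neither server moved, so both costs and both stamps are the old
          ones.\<close>
        then show ?thesis
          using ord[OF \<open>i < k\<close> \<open>j < k\<close>] that \<open>i \<noteq> m\<close> by (simp add: costj new)
      qed
    qed
    ultimately show ?thesis by blast
  qed
qed

theorem theorem13:
  fixes M :: "'p set" and d :: "'p \<Rightarrow> 'p \<Rightarrow> real"
    and k :: nat and C\<^sub>0 :: "nat \<Rightarrow> 'p" and \<tau>\<^sub>0 :: "nat \<Rightarrow> int"
  assumes "uniform_metric M d"
    and "k \<ge> 1"
    and "\<And>i. i < k \<Longrightarrow> C\<^sub>0 i \<in> M"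
    and "inj_on \<tau>\<^sub>0 {..<k}"
    and "\<And>i. i < k \<Longrightarrow> \<tau>\<^sub>0 i \<le> 0"
  shows "fair M d k 1 1 (fifo k C\<^sub>0 \<tau>\<^sub>0)"
  unfolding fair_def
proof (intro allI impI)
  fix \<sigma> :: "'p list" and i
  assume \<sigma>: "set \<sigma> \<subseteq> M" and i: "i < k"
  define c where "c = server_cost d (fifo k C\<^sub>0 \<tau>\<^sub>0) \<sigma>"
  obtain C \<tau> t where state: "fold (fifo_step k) \<sigma> (C\<^sub>0, \<tau>\<^sub>0, 1) = (C, \<tau>, t)"
    using prod_cases3 by blast
  note inv = fifo_invariant[OF assms \<sigma> state, folded c_def]
  \<comment> \<open>An older \<open>i\<close> even has \<open>c i \<le> c j\<close>; a younger one
    uses the other bound, with the roles of \<open>i\<close> and \<open>j\<close> exchanged.\<close>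
  have "c i \<le> c j + 1" if "j < k" for j
  proof (cases "\<tau> i" "\<tau> j" rule: linorder_cases)
    case less
    then show ?thesis using inv i that by fastforce
  next
    case equal
    then have "i = j" using inv i that by (auto dest: inj_onD)
    then show ?thesis by simp
  next
    case greater
    then show ?thesis using inv i that by blast
  qed
  then have "(\<Sum>j<k. c i) \<le> (\<Sum>j<k. c j + 1)"
    by (intro sum_mono) auto
  then have "real k * c i \<le> total_cost d k (fifo k C\<^sub>0 \<tau>\<^sub>0) \<sigma> + real k"
    by (simp add: sum.distrib total_cost_def c_def)
  then show "server_cost d (fifo k C\<^sub>0 \<tau>\<^sub>0) \<sigma> i
      \<le> 1 * (total_cost d k (fifo k C\<^sub>0 \<tau>\<^sub>0) \<sigma> / real k) + 1"
    using \<open>k \<ge> 1\<close> by (simp add: c_def field_simps)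
qed

end
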